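(* Let $\mathbb{D}=\{z\in\mathbb{C}:|z|<1\}$, let $\epsilon>0$, and let $f$ be a meromorphic function on $\mathbb{D}$ satisfying $f^\#(z)\ge\epsilon$ for all $z\in\mathbb{D}$. Then there exist functions $w_1,w_2$ holomorphic on $\mathbb{D}$ such that $$f=\frac{w_1}{w_2}$$ and, for all $z\in\mathbb{D}$, $$|w_1(z)|^2+|w_2(z)|^2\le\frac1\epsilon,\qquad w_1(z)w_2'(z)-w_2(z)w_1'(z)=1,\qquad w_1(z)w_2''(z)-w_2(z)w_1''(z)=0.$$ Moreover, for all $z\in\mathbb{D}$, $$f^\#(z)\le\frac{2/\epsilon}{(1-|z|)^2}\qquad\text{and}\qquad |S_f(z)|\le\frac{4/\epsilon}{(1-|z|)^3}.$$
   Context: For a meromorphic function $f$ on a domain, the spherical derivative is $f^\#=\dfrac{|f'|}{1+|f|^2}$, where at poles of $f$ the value is understood by continuous extension (equivalently, $f^\#=(1/f)^\#$ there). The Schwarzian derivative of $f$ is $S_f=\left(\dfrac{f''}{f'}\right)'-\dfrac12\left(\dfrac{f''}{f'}\right)^2$. The condition $f^\#>0$ everywhere is equivalent to local univalence of $f$ (as a map to the Riemann sphere), and then $S_f$ is holomorphic on the whole domain, its values at poles of $f$ being given by the holomorphic extension. *)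

theory Defs
  imports "HOL-Complex_Analysis.Complex_Analysis"
begin

text \<open>
  A meromorphic function is represented by a function of type \<^typ>\<open>complex \<Rightarrow> complex\<close> that is
  \<^const>\<open>nicely_meromorphic_on\<close> its domain: it is continuous away from its poles and takes the
  dummy value 0 at its poles. That dummy value stands for infinity, so at a pole the quantities
  below are limits rather than the defining expressions evaluated there.
\<close>

definition spherical_deriv :: "(complex \<Rightarrow> complex) \<Rightarrow> complex \<Rightarrow> real" where
  "spherical_deriv f z =
     (let g = (\<lambda>w. norm (deriv f w) / (1 + (norm (f w))\<^sup>2))
      in if is_pole f z then Lim (at z) g else g z)"

definition schwarzian :: "(complex \<Rightarrow> complex) \<Rightarrow> complex \<Rightarrow> complex" where
  "schwarzian f z =
     (let p = (\<lambda>w. deriv (deriv f) w / deriv f w);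
          s = (\<lambda>w. deriv p w - (p w)\<^sup>2 / 2)
      in if is_pole f z then Lim (at z) s else s z)"

end

theory Submission
  imports Defs
begin

text \<open>
  The idea is to look for the numerator and the denominator as a pair with Wronskian
  \<open>w\<^sub>1 w\<^sub>2' - w\<^sub>2 w\<^sub>1' = 1\<close>. If \<open>f = w\<^sub>1 / w\<^sub>2\<close>, this normalisation says \<open>f' = -1 / w\<^sub>2\<^sup>2\<close>, so
  \<open>w\<^sub>2\<close> has to be a square root of \<open>-1 / f'\<close>. Conversely, a holomorphic square root \<open>w\<^sub>2\<close>
  of \<open>-1 / f'\<close>, together with \<open>w\<^sub>1 = f w\<^sub>2\<close>, is such a pair. A positive spherical derivative
  makes the square root exist: away from the poles it gives \<open>f' \<noteq> 0\<close>, and at a pole it forces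
  the reciprocal of \<open>f\<close> to have a simple zero, so that \<open>-1 / f'\<close> extends to a holomorphic
  function whose zeros are exactly the poles of \<open>f\<close>, all of them double
  (\<open>simple_pole_reciprocal\<close>). A function on a disc with only double zeros has a holomorphic
  square root (\<open>holomorphic_sqrt_ball_double_zeros\<close>). This yields
  \<open>locally_univalent_meromorphic_as_quotient\<close>.

  For such a pair a direct computation, extended to the poles by continuity, gives
  \<open>f\<^sup># = 1 / (|w\<^sub>1|\<^sup>2 + |w\<^sub>2|\<^sup>2)\<close> and \<open>S\<^sub>f = 2 (w\<^sub>1' w\<^sub>2'' - w\<^sub>2' w\<^sub>1'')\<close>
  (\<open>quotient_unit_wronskian_invariants\<close>). Hence \<open>f\<^sup># \<ge> \<epsilon>\<close> says precisely that the vector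
  \<open>W = (w\<^sub>1, w\<^sub>2)\<close> satisfies \<open>|W|\<^sup>2 \<le> 1 / \<epsilon>\<close>, and the Cauchy estimates for vector-valued functions
  (\<open>vector_higher_deriv_bound\<close>) bound \<open>|W'|\<close> and \<open>|W''|\<close> on the disc of radius
  \<open>1 - |z|\<close> about \<open>z\<close>. The Cauchy--Schwarz inequality turns the Wronskian identity into
  \<open>1 \<le> |W| |W'|\<close>, that is \<open>f\<^sup># \<le> |W'|\<^sup>2\<close>, and the formula for \<open>S\<^sub>f\<close> into
  \<open>|S\<^sub>f| \<le> 2 |W'| |W''|\<close>.
\<close>

section \<open>Cauchy estimates for pairs of holomorphic functions\<close>

text \<open>
  The Cauchy inequality on the concentric discs of radius \<open>t < R\<close>, in the limit \<open>t \<rightarrow> R\<close>.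
\<close>
lemma higher_deriv_bound_open_ball:
  assumes holf: "f holomorphic_on ball z R" and "0 < R"
    and bound: "\<And>w. w \<in> ball z R \<Longrightarrow> norm (f w) \<le> B"
  shows "norm ((deriv ^^ n) f z) \<le> fact n * B / R ^ n"
proof (rule tendsto_lowerbound)
  show "((\<lambda>t. fact n * B / t ^ n) \<longlongrightarrow> fact n * B / R ^ n) (at_left R)"
    using \<open>0 < R\<close> by (intro tendsto_intros) auto
  have "eventually (\<lambda>t. t \<in> {0<..<R}) (at_left R)"
    by (rule eventually_at_left_real) fact
  thus "eventually (\<lambda>t. norm ((deriv ^^ n) f z) \<le> fact n * B / t ^ n) (at_left R)"
  proof eventually_elim
    case (elim t)
    show ?case
    proof (rule Cauchy_inequality)
      show "f holomorphic_on ball z t" "continuous_on (cball z t) f"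
        using elim by (auto intro!: holomorphic_on_subset[OF holf] 
          holomorphic_on_imp_continuous_on)
      show "norm (f x) \<le> B" if "norm (z - x) = t" for x
        using that elim by (intro bound) (auto simp: dist_norm)
    qed (use elim in auto)
  qed
qed auto

lemma norm_vector2_le:
  fixes a b c d :: complex
  shows "norm (a * c + b * d) \<le> sqrt ((norm a)\<^sup>2 + (norm b)\<^sup>2) * sqrt ((norm c)\<^sup>2 + (norm d)\<^sup>2)"
proof -
  have "norm (a * c + b * d) \<le> norm a * norm c + norm b * norm d"
    by (metis norm_mult norm_triangle_ineq)
  also have "\<dots> = (norm a, norm b) \<bullet> (norm c, norm d)"
    by simp
  also have "\<dots> \<le> norm (norm a, norm b) * norm (norm c, norm d)"
    by (rule norm_cauchy_schwarz)
  finally show ?thesis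
    by (simp add: norm_prod_def)
qed

text \<open>
  The scalar estimate, applied to the linear combination \<open>a u + b v\<close> whose coefficients are the
  conjugates of the derivatives to be bounded. Estimating \<open>u\<close> and \<open>v\<close> separately would lose a
  factor 2 in the bound for the square of the norm, and with it the constant in the bound for
  the Schwarzian derivative.
\<close>
lemma vector_higher_deriv_bound:
  assumes hol: "u holomorphic_on ball z R" "v holomorphic_on ball z R" and "0 < R"
    and bound: "\<And>w. w \<in> ball z R \<Longrightarrow> sqrt ((norm (u w))\<^sup>2 + (norm (v w))\<^sup>2) \<le> M"
  shows "sqrt ((norm ((deriv ^^ n) u z))\<^sup>2 + (norm ((deriv ^^ n) v z))\<^sup>2) \<le> fact n * M / R ^ n"
proof -
  define a b where "a = cnj ((deriv ^^ n) u z)" and "b = cnj ((deriv ^^ n) v z)"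
  define N where "N = sqrt ((norm a)\<^sup>2 + (norm b)\<^sup>2)"
  have "N \<ge> 0" by (simp add: N_def)
  have "0 \<le> M"
    using bound[of z] \<open>0 < R\<close> by (meson centre_in_ball order_trans real_sqrt_ge_zero sum_power2_ge_zero)
  have "norm ((deriv ^^ n) (\<lambda>w. a * u w + b * v w) z) \<le> fact n * (N * M) / R ^ n"
  proof (rule higher_deriv_bound_open_ball)
    show "(\<lambda>w. a * u w + b * v w) holomorphic_on ball z R"
      by (intro holomorphic_intros hol)
    fix w assume "w \<in> ball z R"
    hence "N * sqrt ((norm (u w))\<^sup>2 + (norm (v w))\<^sup>2) \<le> N * M"
      using bound \<open>N \<ge> 0\<close> by (intro mult_left_mono) auto
    thus "norm (a * u w + b * v w) \<le> N * M"
      using norm_vector2_le[of a "u w" b "v w"] by (simp add: N_def)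
  qed fact
  also have "(deriv ^^ n) (\<lambda>w. a * u w + b * v w) z = a * (deriv ^^ n) u z + b * (deriv ^^ n) v z"
  proof -
    have "(deriv ^^ n) (\<lambda>w. a * u w + b * v w) z
        = (deriv ^^ n) (\<lambda>w. a * u w) z + (deriv ^^ n) (\<lambda>w. b * v w) z"
      using \<open>0 < R\<close> by (intro higher_deriv_add[of _ "ball z R"] holomorphic_intros hol) auto
    thus ?thesis
      using \<open>0 < R\<close> by (simp add: higher_deriv_cmult[OF hol(1)] higher_deriv_cmult[OF hol(2)])
  qed
  also have "\<dots> = of_real (N\<^sup>2)"
    by (simp add: a_def b_def N_def complex_norm_square mult.commute del: of_real_power)
  finally have "N * N \<le> N * (fact n * M / R ^ n)"
    by (simp add: power2_eq_square norm_mult mult_ac)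
  hence "N \<le> fact n * M / R ^ n"
    using \<open>0 \<le> N\<close> \<open>0 \<le> M\<close> \<open>0 < R\<close>
    by (cases "N = 0") (auto simp del: times_divide_eq_right)
  thus ?thesis
    by (simp add: N_def a_def b_def)
qed

section \<open>Square roots of holomorphic functions with double zeros\<close>

text \<open>
  Each double zero \<open>a\<close> is divided out: a square root of \<open>g / (z - a)\<^sup>2\<close>, multiplied by \<open>z - a\<close>,
  is a square root of \<open>g\<close>. When no zeros are left, simple connectivity gives the root.
  Double zeros are described by a local factorisation because that description passes
  directly to the quotient.
\<close>
lemma holomorphic_sqrt_finite_double_zeros:
  assumes "finite Z" "open S" "simply_connected S" "g holomorphic_on S"
    and "\<And>z. z \<in> S - Z \<Longrightarrow> g z \<noteq> 0"
    and "\<And>a. a \<in> Z \<Longrightarrow> \<exists>r>0. \<exists>v. v holomorphic_on ball a r \<and> v a \<noteq> 0 \<and>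
                      (\<forall>w\<in>ball a r. g w = (w - a)\<^sup>2 * v w)"
  shows "\<exists>s. s holomorphic_on S \<and> (\<forall>z\<in>S. g z = (s z)\<^sup>2)"
  using assms(1,4-)
proof (induction Z arbitrary: g rule: finite_induct)
  case empty
  thus ?case
    using simply_connected_eq_holomorphic_sqrt[OF \<open>open S\<close>] \<open>simply_connected S\<close> by auto
next
  case (insert a Z)
  obtain r v where v: "r > 0" "v holomorphic_on ball a r" "v a \<noteq> 0"
      "\<And>w. w \<in> ball a r \<Longrightarrow> g w = (w - a)\<^sup>2 * v w"
    using insert.prems(3)[of a] by auto
  define g' where "g' = (\<lambda>w. if w = a then v a else g w / (w - a)\<^sup>2)"
  have g: "g w = (w - a)\<^sup>2 * g' w" for w
    using v(1) v(4)[of a] by (auto simp: g'_def)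
  have "\<exists>s. s holomorphic_on S \<and> (\<forall>z\<in>S. g' z = (s z)\<^sup>2)"
  proof (rule insert.IH)
    have "(\<lambda>w. g w / (w - a)\<^sup>2) holomorphic_on (S - {a})"
      by (intro holomorphic_intros holomorphic_on_subset[OF insert.prems(1)]) auto
    hence "g' holomorphic_on (S - {a})"
      by (rule holomorphic_transform) (auto simp: g'_def)
    moreover have "g' holomorphic_on ball a r"
      by (rule holomorphic_transform[OF v(2)]) (auto simp: g'_def v)
    ultimately have "g' holomorphic_on (S - {a} \<union> ball a r)"
      using \<open>open S\<close> by (intro holomorphic_on_Un) auto
    thus "g' holomorphic_on S"
      by (rule holomorphic_on_subset) (use \<open>r > 0\<close> in auto)
    show "g' z \<noteq> 0" if "z \<in> S - Z" for z
      using that insert.prems(2)[of z] v(3) by (auto simp: g'_def)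
    fix b assume b: "b \<in> Z"
    hence "b \<noteq> a" using insert.hyps by auto
    obtain q u where u: "q > 0" "u holomorphic_on ball b q" "u b \<noteq> 0"
      "\<And>w. w \<in> ball b q \<Longrightarrow> g w = (w - b)\<^sup>2 * u w"
      using insert.prems(3)[of b] b by auto
    \<comment> \<open>On a disc about \<open>b\<close> that avoids \<open>a\<close>, dividing by \<open>(w - a)\<^sup>2\<close> only changes the unit factor.\<close>
    define q' where "q' = min q (dist a b)"
    have a_notin: "a \<notin> ball b q'"
      by (auto simp: q'_def dist_commute)
    show "\<exists>r>0. \<exists>v. v holomorphic_on ball b r \<and> v b \<noteq> 0 \<and> (\<forall>w\<in>ball b r. g' w = (w - b)\<^sup>2 * v w)"
    proof (intro exI conjI ballI)
      show "q' > 0" using u(1) \<open>b \<noteq> a\<close> by (simp add: q'_def)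
      show "(\<lambda>w. u w / (w - a)\<^sup>2) holomorphic_on ball b q'"
        by (intro holomorphic_intros holomorphic_on_subset[OF u(2)]) (use a_notin in \<open>auto simp: q'_def\<close>)
      show "u b / (b - a)\<^sup>2 \<noteq> 0" using u(3) \<open>b \<noteq> a\<close> by auto
      show "g' w = (w - b)\<^sup>2 * (u w / (w - a)\<^sup>2)" if "w \<in> ball b q'" for w
        using that a_notin u(4)[of w] by (auto simp: g'_def q'_def)
    qed
  qed
  then obtain s where s: "s holomorphic_on S" "\<And>z. z \<in> S \<Longrightarrow> g' z = (s z)\<^sup>2"
    by blast
  show ?case
    by (rule exI[of _ "\<lambda>w. (w - a) * s w"])
       (auto intro!: holomorphic_intros s simp: g s(2) power_mult_distrib)
qed

text \<open>
  Where \<open>s + t\<close> does not vanish the two roots agree, since \<open>(s - t) (s + t) = 0\<close>. This is an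
  open set containing \<open>p\<close>, so analytic continuation applies.
\<close>
lemma holomorphic_sqrt_unique:
  assumes "open S" "connected S" "s holomorphic_on S" "t holomorphic_on S"
    and eq: "\<And>z. z \<in> S \<Longrightarrow> (s z)\<^sup>2 = (t z)\<^sup>2" and p: "p \<in> S" "s p = t p" "s p \<noteq> 0" and "z \<in> S"
  shows "s z = t z"
proof -
  define U where "U = {w\<in>S. s w + t w \<noteq> 0}"
  have "continuous_on S (\<lambda>w. s w + t w)"
    by (intro continuous_intros holomorphic_on_imp_continuous_on assms)
  hence "open U"
    using continuous_open_preimage[OF _ \<open>open S\<close>, of "\<lambda>w. s w + t w" "- {0}"]
    by (simp add: U_def vimage_def Int_def open_Compl)
  moreover have "p \<in> U"
    using p by (auto simp: U_def)
  moreover have "s w = t w" if "w \<in> U" for w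
    using that eq[of w] by (auto simp: U_def power2_eq_iff)
  moreover have "U \<subseteq> S"
    by (auto simp: U_def)
  ultimately show ?thesis
    using analytic_continuation_open[of U S s t z] assms(1-4) \<open>z \<in> S\<close> by blast
qed

text \<open>
  The zeros may accumulate at the boundary circle, but each smaller concentric disc contains only
  finitely many. The square roots on the smaller discs are glued; fixing their
  value at the point \<open>p\<close> removes the ambiguity of sign.
\<close>
lemma holomorphic_sqrt_ball_double_zeros:
  assumes holg: "g holomorphic_on ball c R"
    and p: "p \<in> ball c R" "g p \<noteq> 0"
    and zeros: "\<And>a. a \<in> ball c R \<Longrightarrow> g a = 0 \<Longrightarrow>
       \<exists>r>0. \<exists>v. v holomorphic_on ball a r \<and> v a \<noteq> 0 \<and> (\<forall>w\<in>ball a r. g w = (w - a)\<^sup>2 * v w)"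
  shows "\<exists>s. s holomorphic_on ball c R \<and> (\<forall>z\<in>ball c R. g z = (s z)\<^sup>2)"
proof -
  define T where "T = {dist c p<..<R}"
  have "\<exists>s. s holomorphic_on ball c t \<and> (\<forall>z\<in>ball c t. g z = (s z)\<^sup>2) \<and> s p = csqrt (g p)"
    if t: "t \<in> T" for t
  proof -
    have sub: "cball c t \<subseteq> ball c R" using t by (auto simp: T_def)
    define Z where "Z = {z\<in>cball c t. g z = 0}"
    have "finite Z"
    proof (cases "g constant_on ball c R")
      case True
      hence "Z = {}"
        using p sub by (force simp: Z_def constant_on_def)
      thus ?thesis by simp
    next
      case False
      thus ?thesis
        unfolding Z_def by (intro holomorphic_compact_finite_zeros[OF holg]) (use sub in auto)
    qed
    moreover have "simply_connected (ball c t)"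
      by (simp add: convex_imp_simply_connected)
    moreover have "g holomorphic_on ball c t"
      by (rule holomorphic_on_subset[OF holg]) (use sub in auto)
    moreover have "g z \<noteq> 0" if "z \<in> ball c t - Z" for z
      using that by (auto simp: Z_def)
    moreover have "a \<in> ball c R" "g a = 0" if "a \<in> Z" for a
      using that sub by (auto simp: Z_def)
    ultimately obtain s where s: "s holomorphic_on ball c t" "\<forall>z\<in>ball c t. g z = (s z)\<^sup>2"
      using holomorphic_sqrt_finite_double_zeros[of Z "ball c t" g] zeros by blast
    have "p \<in> ball c t" using t by (auto simp: T_def)
    hence "(s p)\<^sup>2 = (csqrt (g p))\<^sup>2" using s by auto
    hence "s p = csqrt (g p) \<or> - s p = csqrt (g p)"
      by (metis power2_eq_iff minus_minus)
    thus ?thesis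
    proof
      assume "- s p = csqrt (g p)"
      thus ?thesis using s by (intro exI[of _ "\<lambda>w. - s w"]) (auto intro!: holomorphic_intros)
    qed (use s in blast)
  qed
  then obtain \<sigma> where \<sigma>: "\<And>t. t \<in> T \<Longrightarrow> \<sigma> t holomorphic_on ball c t"
      "\<And>t z. t \<in> T \<Longrightarrow> z \<in> ball c t \<Longrightarrow> g z = (\<sigma> t z)\<^sup>2" "\<And>t. t \<in> T \<Longrightarrow> \<sigma> t p = csqrt (g p)"
    by metis
  have mono: "\<sigma> t z = \<sigma> t' z" if "t \<in> T" "t' \<in> T" "t \<le> t'" "z \<in> ball c t" for t t' z
  proof (rule holomorphic_sqrt_unique[of "ball c t" "\<sigma> t" "\<sigma> t'" p z])
    have sub: "ball c t \<subseteq> ball c t'" using that by auto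
    show "\<sigma> t' holomorphic_on ball c t"
      using \<sigma>(1)[OF that(2)] sub by (rule holomorphic_on_subset)
    show "(\<sigma> t z)\<^sup>2 = (\<sigma> t' z)\<^sup>2" if "z \<in> ball c t" for z
      using \<sigma>(2)[of t z] \<sigma>(2)[of t' z] \<open>t \<in> T\<close> \<open>t' \<in> T\<close> that sub by auto
    show "p \<in> ball c t" using that by (auto simp: T_def)
    show "\<sigma> t holomorphic_on ball c t" "\<sigma> t p = \<sigma> t' p" "\<sigma> t p \<noteq> 0"
      using that(1,2) \<sigma> p by auto
  qed (use that(4) in auto)
  \<comment> \<open>A radius in \<open>T\<close> whose disc contains \<open>z\<close>.\<close>
  define \<tau> where "\<tau> = (\<lambda>z. (max (dist c z) (dist c p) + R) / 2)"
  have \<tau>: "\<tau> z \<in> T" "z \<in> ball c (\<tau> z)" if "z \<in> ball c R" for z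
    using that p by (auto simp: \<tau>_def T_def)
  define s where "s = (\<lambda>z. \<sigma> (\<tau> z) z)"
  have s: "s z = \<sigma> t z" if "t \<in> T" "z \<in> ball c t" for t z
  proof -
    have "z \<in> ball c R" using that by (auto simp: T_def)
    hence \<tau>z: "\<tau> z \<in> T" "z \<in> ball c (\<tau> z)"
      by (rule \<tau>)+
    show ?thesis
      unfolding s_def using linear[of t "\<tau> z"]
    proof
      assume "t \<le> \<tau> z"
      thus "\<sigma> (\<tau> z) z = \<sigma> t z" by (rule mono[OF that(1) \<tau>z(1) _ that(2), symmetric])
    next
      assume "\<tau> z \<le> t"
      thus "\<sigma> (\<tau> z) z = \<sigma> t z" by (rule mono[OF \<tau>z(1) that(1) _ \<tau>z(2)])
    qed
  qed
  have "s analytic_on {z}" if "z \<in> ball c R" for z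
  proof -
    have "s holomorphic_on ball c (\<tau> z)"
      by (rule holomorphic_transform[OF \<sigma>(1)]) (use \<tau>[OF that] s in auto)
    thus ?thesis
      using \<tau>(2)[OF that] by (auto simp: analytic_at)
  qed
  hence "s holomorphic_on ball c R"
    using analytic_imp_holomorphic analytic_on_analytic_at by blast
  moreover have "g z = (s z)\<^sup>2" if "z \<in> ball c R" for z
    using \<sigma>(2)[OF \<tau>[OF that]] by (simp add: s_def)
  ultimately show ?thesis by blast
qed

section \<open>Quotients of pairs with unit Wronskian\<close>

text \<open>The expression is the derivative of the Wronskian: the terms \<open>w\<^sub>1' w\<^sub>2'\<close> cancel.\<close>
lemma wronskian_const_imp_deriv2:
  assumes "open A" "w1 holomorphic_on A" "w2 holomorphic_on A"
    and W: "\<And>z. z \<in> A \<Longrightarrow> w1 z * deriv w2 z - w2 z * deriv w1 z = c" and "z \<in> A"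
  shows "w1 z * deriv (deriv w2) z - w2 z * deriv (deriv w1) z = 0"
proof -
  have D: "(w has_field_derivative deriv w z) (at z)"
          "(deriv w has_field_derivative deriv (deriv w) z) (at z)"
    if "w holomorphic_on A" for w
    using that assms by (auto intro!: holomorphic_derivI[of _ A] holomorphic_deriv)
  have "((\<lambda>z. w1 z * deriv w2 z - w2 z * deriv w1 z) has_field_derivative
          (w1 z * deriv (deriv w2) z - w2 z * deriv (deriv w1) z)) (at z)"
    by (rule derivative_eq_intros D assms refl)+ (simp add: algebra_simps)
  moreover have "((\<lambda>z. w1 z * deriv w2 z - w2 z * deriv w1 z) has_field_derivative 0) (at z)"
    by (rule has_field_derivative_transform_within_open[of "\<lambda>_. c" _ _ A]) (use assms in auto)
  ultimately show ?thesis
    by (rule DERIV_unique)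
qed

text \<open>
  From \<open>f' = -1 / w\<^sub>2\<^sup>2\<close> follows \<open>f'' / f' = -2 w\<^sub>2' / w\<^sub>2\<close>, and then
  \<open>S\<^sub>f = -2 w\<^sub>2'' / w\<^sub>2\<close>. The equivalent form stated here has no denominator, so it is
  continuous across the zeros of \<open>w\<^sub>2\<close>.
\<close>
lemma quotient_unit_wronskian_derivs:
  assumes "open B" "w1 holomorphic_on B" "w2 holomorphic_on B"
    and W: "\<And>z. z \<in> B \<Longrightarrow> w1 z * deriv w2 z - w2 z * deriv w1 z = 1"
    and nz: "\<And>z. z \<in> B \<Longrightarrow> w2 z \<noteq> 0" and f: "\<And>z. z \<in> B \<Longrightarrow> f z = w1 z / w2 z"
    and "z \<in> B"
  shows "deriv f z = - 1 / (w2 z)\<^sup>2"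
    and "deriv (\<lambda>w. deriv (deriv f) w / deriv f w) z - (deriv (deriv f) z / deriv f z)\<^sup>2 / 2
           = 2 * (deriv w1 z * deriv (deriv w2) z - deriv w2 z * deriv (deriv w1) z)"
proof -
  have D: "(w has_field_derivative deriv w z) (at z)"
          "(deriv w has_field_derivative deriv (deriv w) z) (at z)"
    if "w holomorphic_on B" "z \<in> B" for w z
    using that assms(1) by (auto intro!: holomorphic_derivI[of _ B] holomorphic_deriv)
  have ev: "eventually (\<lambda>w. w \<in> B) (nhds z)" if "z \<in> B" for z
    using that \<open>open B\<close> by (rule eventually_nhds_in_open[rotated])
  have d1: "deriv f z = - 1 / (w2 z)\<^sup>2" if z: "z \<in> B" for z
  proof -
    have "deriv f z = deriv (\<lambda>z. w1 z / w2 z) z"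
      using ev[OF z] f by (intro deriv_cong_ev refl) (auto elim: eventually_mono)
    also have "((\<lambda>z. w1 z / w2 z) has_field_derivative - 1 / (w2 z)\<^sup>2) (at z)"
      by (rule derivative_eq_intros D assms z nz refl)+
         (use W[OF z] nz[OF z] in \<open>simp add: power2_eq_square field_simps\<close>)
    hence "deriv (\<lambda>z. w1 z / w2 z) z = - 1 / (w2 z)\<^sup>2"
      by (rule DERIV_imp_deriv)
    finally show ?thesis .
  qed
  have d2: "deriv (deriv f) z = 2 * deriv w2 z / w2 z ^ 3" if z: "z \<in> B" for z
  proof -
    have "deriv (deriv f) z = deriv (\<lambda>z. - 1 / (w2 z)\<^sup>2) z"
      using ev[OF z] d1 by (intro deriv_cong_ev refl) (auto elim: eventually_mono)
    also have "((\<lambda>z. - 1 / (w2 z)\<^sup>2) has_field_derivative 2 * deriv w2 z / w2 z ^ 3) (at z)"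
      by (rule derivative_eq_intros D assms z refl)+
         (use nz[OF z] in \<open>auto simp add: power2_eq_square power3_eq_cube field_simps\<close>)
    hence "deriv (\<lambda>z. - 1 / (w2 z)\<^sup>2) z = 2 * deriv w2 z / w2 z ^ 3"
      by (rule DERIV_imp_deriv)
    finally show ?thesis .
  qed
  have p: "deriv (deriv f) z / deriv f z = - 2 * deriv w2 z / w2 z" if "z \<in> B" for z
    using nz[OF that] by (simp add: d1 d2 that power2_eq_square power3_eq_cube)
  have "deriv (\<lambda>w. deriv (deriv f) w / deriv f w) z = deriv (\<lambda>z. - 2 * deriv w2 z / w2 z) z"
    using ev[OF \<open>z \<in> B\<close>] p by (intro deriv_cong_ev refl) (auto elim: eventually_mono)
  also have "((\<lambda>z. - 2 * deriv w2 z / w2 z) has_field_derivative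
          2 * (deriv w2 z)\<^sup>2 / (w2 z)\<^sup>2 - 2 * deriv (deriv w2) z / w2 z) (at z)"
    by (rule derivative_eq_intros D assms refl)+
       (use nz[OF \<open>z \<in> B\<close>] in \<open>auto simp add: power2_eq_square field_simps\<close>)
  hence "deriv (\<lambda>z. - 2 * deriv w2 z / w2 z) z
       = 2 * (deriv w2 z)\<^sup>2 / (w2 z)\<^sup>2 - 2 * deriv (deriv w2) z / w2 z"
    by (rule DERIV_imp_deriv)
  finally have "deriv (\<lambda>w. deriv (deriv f) w / deriv f w) z - (deriv (deriv f) z / deriv f z)\<^sup>2 / 2
      = - 2 * deriv (deriv w2) z / w2 z"
    by (simp add: p[OF \<open>z \<in> B\<close>] power_divide power_mult_distrib)
  also have "\<dots> = 2 * (deriv w1 z * deriv (deriv w2) z - deriv w2 z * deriv (deriv w1) z)"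
  proof -
    have "w1 z * deriv (deriv w2) z = w2 z * deriv (deriv w1) z"
      using wronskian_const_imp_deriv2[OF assms(1-4) \<open>z \<in> B\<close>] by simp
    hence "w2 z * (deriv w1 z * deriv (deriv w2) z - deriv w2 z * deriv (deriv w1) z)
       = - (w1 z * deriv w2 z - w2 z * deriv w1 z) * deriv (deriv w2) z"
      by (simp add: algebra_simps)
    hence "w2 z * (deriv w1 z * deriv (deriv w2) z - deriv w2 z * deriv (deriv w1) z)
       = - deriv (deriv w2) z"
      by (simp add: W[OF \<open>z \<in> B\<close>])
    hence "deriv w1 z * deriv (deriv w2) z - deriv w2 z * deriv (deriv w1) z
       = - deriv (deriv w2) z / w2 z"
      using nz[OF \<open>z \<in> B\<close>] by (metis nonzero_mult_div_cancel_left)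
    thus ?thesis
      by simp
  qed
  finally show "deriv (\<lambda>w. deriv (deriv f) w / deriv f w) z - (deriv (deriv f) z / deriv f z)\<^sup>2 / 2
           = 2 * (deriv w1 z * deriv (deriv w2) z - deriv w2 z * deriv (deriv w1) z)" .
  show "deriv f z = - 1 / (w2 z)\<^sup>2"
    by (rule d1) fact
qed

text \<open>
  Both right-hand sides are continuous on all of \<open>A\<close>, the first because a unit Wronskian excludes
  common zeros. At a pole they are therefore the limits by which the
  two invariants are defined there.
\<close>
lemma quotient_unit_wronskian_invariants:
  assumes "open A" and hol: "w1 holomorphic_on A" "w2 holomorphic_on A"
    and W: "\<And>z. z \<in> A \<Longrightarrow> w1 z * deriv w2 z - w2 z * deriv w1 z = 1"
    and pole: "\<And>z. z \<in> A \<Longrightarrow> is_pole f z \<longleftrightarrow> w2 z = 0"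
    and f: "\<And>z. z \<in> A \<Longrightarrow> f z = w1 z / w2 z"
    and z: "z \<in> A"
  shows "spherical_deriv f z = 1 / ((norm (w1 z))\<^sup>2 + (norm (w2 z))\<^sup>2)"
    and "schwarzian f z = 2 * (deriv w1 z * deriv (deriv w2) z - deriv w2 z * deriv (deriv w1) z)"
proof -
  define sp where "sp = (\<lambda>w. norm (deriv f w) / (1 + (norm (f w))\<^sup>2))"
  define sc where "sc = (\<lambda>w. deriv (\<lambda>w. deriv (deriv f) w / deriv f w) w - (deriv (deriv f) w / deriv f w)\<^sup>2 / 2)"
  define sp' where "sp' = (\<lambda>z. 1 / ((norm (w1 z))\<^sup>2 + (norm (w2 z))\<^sup>2))"
  define sc' where "sc' = (\<lambda>z. 2 * (deriv w1 z * deriv (deriv w2) z - deriv w2 z * deriv (deriv w1) z))"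
  define B where "B = {w\<in>A. w2 w \<noteq> 0}"
  have "open B"
    using continuous_open_preimage[OF holomorphic_on_imp_continuous_on[OF hol(2)] \<open>open A\<close>, of "- {0}"]
    by (simp add: B_def vimage_def Int_def open_Compl)
  have B: "sc w = sc' w" "sp w = sp' w" if "w \<in> B" for w
  proof -
    have sub: "w1 holomorphic_on B" "w2 holomorphic_on B"
      using hol by (auto simp: B_def elim: holomorphic_on_subset)
    note * = quotient_unit_wronskian_derivs[OF \<open>open B\<close> sub, of f, OF _ _ _ that]
    show "sc w = sc' w"
      unfolding sc_def sc'_def by (rule *) (auto simp: B_def W f)
    have "deriv f w = - 1 / (w2 w)\<^sup>2"
      by (rule *) (auto simp: B_def W f)
    hence "norm (deriv f w) = 1 / (norm (w2 w))\<^sup>2"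
      by (simp add: norm_divide norm_power)
    moreover have "w2 w \<noteq> 0" "f w = w1 w / w2 w"
      using that f by (auto simp: B_def)
    hence "1 + (norm (f w))\<^sup>2 = ((norm (w1 w))\<^sup>2 + (norm (w2 w))\<^sup>2) / (norm (w2 w))\<^sup>2"
      by (simp add: norm_divide power_divide add_divide_distrib)
    ultimately show "sp w = sp' w"
      using \<open>w2 w \<noteq> 0\<close> by (simp add: sp_def sp'_def)
  qed
  have nz: "(norm (w1 z))\<^sup>2 + (norm (w2 z))\<^sup>2 \<noteq> 0"
    using W[OF z] by (auto simp: add_nonneg_eq_0_iff)
  have isCont: "isCont w z" if "w holomorphic_on A" for w
    using that z \<open>open A\<close> by (metis holomorphic_on_imp_continuous_on continuous_on_eq_continuous_at)
  have "isCont sp' z" "isCont sc' z"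
    unfolding sp'_def sc'_def
    by (intro continuous_intros isCont holomorphic_deriv hol nz \<open>open A\<close>)+
  hence cont: "sp' \<midarrow>z\<rightarrow> sp' z" "sc' \<midarrow>z\<rightarrow> sc' z"
    by (simp_all add: isCont_def)
  have "spherical_deriv f z = sp' z \<and> schwarzian f z = sc' z"
  proof (cases "is_pole f z")
    case True
    have "eventually (\<lambda>w. w \<in> A) (at z)"
      using \<open>open A\<close> z by (rule eventually_at_in_open')
    moreover have "eventually (\<lambda>w. f w \<noteq> 0) (at z)"
      using True by (rule non_zero_neighbour_pole)
    ultimately have ev: "eventually (\<lambda>w. w \<in> B) (at z)"
      by eventually_elim (auto simp: B_def f)
    have "sp \<midarrow>z\<rightarrow> sp' z"
      by (rule Lim_transform_eventually[OF cont(1)]) (use ev B in \<open>auto elim: eventually_mono\<close>)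
    moreover have "sc \<midarrow>z\<rightarrow> sc' z"
      by (rule Lim_transform_eventually[OF cont(2)]) (use ev B in \<open>auto elim: eventually_mono\<close>)
    ultimately have "Lim (at z) sp = sp' z" "Lim (at z) sc = sc' z"
      by (auto intro!: tendsto_Lim)
    thus ?thesis
      using True by (simp add: spherical_deriv_def schwarzian_def sp_def sc_def Let_def)
  next
    case False
    hence "z \<in> B" using pole z by (auto simp: B_def)
    thus ?thesis
      using False B[of z] by (simp add: spherical_deriv_def schwarzian_def sp_def sc_def Let_def)
  qed
  thus "spherical_deriv f z = 1 / ((norm (w1 z))\<^sup>2 + (norm (w2 z))\<^sup>2)"
    and "schwarzian f z = 2 * (deriv w1 z * deriv (deriv w2) z - deriv w2 z * deriv (deriv w1) z)"
    by (simp_all add: sp'_def sc'_def)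
qed

section \<open>Poles with positive spherical derivative\<close>
lemma pole_reciprocal:
  assumes "isolated_singularity_at f z" "is_pole f z"
  obtains r h where "r > 0" "h holomorphic_on ball z r" "h z = 0"
    "f holomorphic_on ball z r - {z}"
    "\<And>w. w \<in> ball z r - {z} \<Longrightarrow> h w \<noteq> 0" "\<And>w. w \<in> ball z r - {z} \<Longrightarrow> f w = 1 / h w"
    "\<And>w. w \<in> ball z r - {z} \<Longrightarrow> deriv f w = - deriv h w / (h w)\<^sup>2"
proof -
  obtain r1 where r1: "r1 > 0" "f analytic_on ball z r1 - {z}"
    using assms(1) by (auto simp: isolated_singularity_at_def)
  obtain r2 where r2: "r2 > 0" "\<And>w. w \<noteq> z \<Longrightarrow> dist w z < r2 \<Longrightarrow> f w \<noteq> 0"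
    using non_zero_neighbour_pole[OF assms(2)] by (auto simp: eventually_at)
  define r where "r = min r1 r2"
  define h where "h = (\<lambda>w. if w = z then 0 else inverse (f w))"
  have r: "r > 0" using r1 r2 by (simp add: r_def)
  have holf: "f holomorphic_on ball z r - {z}"
    using analytic_imp_holomorphic[OF r1(2)] by (rule holomorphic_on_subset) (auto simp: r_def)
  have fnz: "f w \<noteq> 0" if "w \<in> ball z r - {z}" for w
    using that r2(2)[of w] by (auto simp: r_def dist_commute)
  have holh: "h holomorphic_on ball z r"
    unfolding h_def by (rule is_pole_inverse_holomorphic) (use holf fnz assms in auto)
  have fh: "f w = 1 / h w" and hnz: "h w \<noteq> 0" if "w \<in> ball z r - {z}" for w
    using that fnz[OF that] by (auto simp: h_def divide_simps)
  have "deriv f w = - deriv h w / (h w)\<^sup>2" if w: "w \<in> ball z r - {z}" for w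
  proof -
    have "deriv f w = deriv (\<lambda>w. 1 / h w) w"
    proof (intro deriv_cong_ev refl)
      have "eventually (\<lambda>x. x \<in> ball z r - {z}) (nhds w)"
        by (rule eventually_nhds_in_open[OF _ w]) (auto intro: open_delete)
      thus "eventually (\<lambda>x. f x = 1 / h x) (nhds w)"
        by eventually_elim (rule fh)
    qed
    also have "(h has_field_derivative deriv h w) (at w)"
      using holh w by (intro holomorphic_derivI[of _ "ball z r"]) auto
    hence "((\<lambda>w. 1 / h w) has_field_derivative - deriv h w / (h w)\<^sup>2) (at w)"
      using hnz[OF w] by (auto intro!: derivative_eq_intros simp: power2_eq_square)
    hence "deriv (\<lambda>w. 1 / h w) w = - deriv h w / (h w)\<^sup>2"
      by (rule DERIV_imp_deriv)
    finally show ?thesis .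
  qed
  thus ?thesis
    using that[OF r holh _ holf hnz fh] by (simp add: h_def)
qed

lemma holomorphic_factor_zero:
  assumes "h holomorphic_on S" "open S" "h z = 0"
  obtains k where "k holomorphic_on S" "k z = deriv h z" "\<And>w. h w = (w - z) * k w"
proof
  show "(\<lambda>w. if w = z then deriv h z else (h w - h z) / (w - z)) holomorphic_on S"
    by (rule pole_lemma_open) fact+
qed (auto simp: assms)

text \<open>
  In terms of \<open>h = 1 / f\<close> the spherical derivative is \<open>|h'| / (1 + |h|\<^sup>2)\<close>, whose limit at the
  pole is \<open>|h'(z)|\<close>. If this is not zero, \<open>h\<close> has a simple zero, expressed by the
  zero-free cofactor \<open>k\<close>.
\<close>
lemma simple_pole_reciprocal:
  assumes "open A" "z \<in> A" "isolated_singularity_at f z" "is_pole f z" "spherical_deriv f z \<noteq> 0"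
  obtains r h k where "r > 0" "ball z r \<subseteq> A" "h holomorphic_on ball z r" "k holomorphic_on ball z r"
    "f holomorphic_on ball z r - {z}"
    "\<And>w. h w = (w - z) * k w"
    "\<And>w. w \<in> ball z r \<Longrightarrow> k w \<noteq> 0" "\<And>w. w \<in> ball z r \<Longrightarrow> deriv h w \<noteq> 0"
    "\<And>w. w \<in> ball z r - {z} \<Longrightarrow> f w = 1 / h w"
    "\<And>w. w \<in> ball z r - {z} \<Longrightarrow> deriv f w = - deriv h w / (h w)\<^sup>2"
    "\<And>w. w \<in> ball z r - {z} \<Longrightarrow> \<not> is_pole f w"
proof -
  obtain r h where h: "r > 0" "h holomorphic_on ball z r" "h z = 0"
    "f holomorphic_on ball z r - {z}"
    "\<And>w. w \<in> ball z r - {z} \<Longrightarrow> h w \<noteq> 0" "\<And>w. w \<in> ball z r - {z} \<Longrightarrow> f w = 1 / h w"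
    "\<And>w. w \<in> ball z r - {z} \<Longrightarrow> deriv f w = - deriv h w / (h w)\<^sup>2"
    using pole_reciprocal[OF assms(3,4)] by metis
  obtain k where k: "k holomorphic_on ball z r" "k z = deriv h z" "\<And>w. h w = (w - z) * k w"
    using holomorphic_factor_zero[of h "ball z r" z] h by auto
  have holh': "deriv h holomorphic_on ball z r"
    by (intro holomorphic_deriv h) auto
  have isCont: "isCont u z" if "u holomorphic_on ball z r" for u
    using that h(1)
    by (metis centre_in_ball holomorphic_on_imp_continuous_on continuous_on_eq_continuous_at open_ball)
  have "spherical_deriv f z = norm (deriv h z)"
  proof -
    have "isCont (\<lambda>w. norm (deriv h w) / ((norm (h w))\<^sup>2 + 1)) z"
      by (intro continuous_intros isCont holh' h) (auto simp: add_nonneg_eq_0_iff)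
    hence "(\<lambda>w. norm (deriv h w) / ((norm (h w))\<^sup>2 + 1)) \<midarrow>z\<rightarrow> norm (deriv h z)"
      by (simp add: isCont_def h(3))
    moreover have "eventually (\<lambda>w. w \<in> ball z r - {z}) (at z)"
      using h(1) by (intro eventually_at_in_open) auto
    hence "eventually (\<lambda>w. norm (deriv h w) / ((norm (h w))\<^sup>2 + 1)
               = norm (deriv f w) / (1 + (norm (f w))\<^sup>2)) (at z)"
    proof eventually_elim
      case (elim w)
      have "1 + (norm (f w))\<^sup>2 = ((norm (h w))\<^sup>2 + 1) / (norm (h w))\<^sup>2"
        using h(5)[OF elim] by (simp add: h(6)[OF elim] norm_divide power_divide add_divide_distrib)
      moreover have "norm (deriv f w) = norm (deriv h w) / (norm (h w))\<^sup>2"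
        by (simp add: h(7)[OF elim] norm_divide norm_power)
      ultimately show ?case
        using h(5)[OF elim] by simp
    qed
    ultimately have "(\<lambda>w. norm (deriv f w) / (1 + (norm (f w))\<^sup>2)) \<midarrow>z\<rightarrow> norm (deriv h z)"
      by (rule Lim_transform_eventually)
    hence "Lim (at z) (\<lambda>w. norm (deriv f w) / (1 + (norm (f w))\<^sup>2)) = norm (deriv h z)"
      by (intro tendsto_Lim) auto
    thus ?thesis
      using assms(4) by (simp add: spherical_deriv_def Let_def)
  qed
  hence nz: "deriv h z \<noteq> 0" using assms(5) by auto
  have ev_nz: "eventually (\<lambda>w. u w \<noteq> 0) (nhds z)" if "u holomorphic_on ball z r" "u z \<noteq> 0" for u
    using isCont[OF that(1)] that(2)
    by (intro tendsto_imp_eventually_ne) (auto simp: isCont_def tendsto_at_iff_tendsto_nhds)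
  have "eventually (\<lambda>w. k w \<noteq> 0) (nhds z)" "eventually (\<lambda>w. deriv h w \<noteq> 0) (nhds z)"
    using nz k(2) by (intro ev_nz k(1) holh'; simp)+
  moreover have "eventually (\<lambda>w. w \<in> A) (nhds z)"
    using assms by (intro eventually_nhds_in_open)
  ultimately have "eventually (\<lambda>w. k w \<noteq> 0 \<and> deriv h w \<noteq> 0 \<and> w \<in> A) (nhds z)"
    by eventually_elim auto
  then obtain q where q: "q > 0" "\<And>w. dist w z < q \<Longrightarrow> k w \<noteq> 0 \<and> deriv h w \<noteq> 0 \<and> w \<in> A"
    by (auto simp: eventually_nhds_metric)
  show ?thesis
  proof (rule that[of "min r q" h k])
    show "h holomorphic_on ball z (min r q)" "k holomorphic_on ball z (min r q)"
      "f holomorphic_on ball z (min r q) - {z}"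
      by (rule holomorphic_on_subset[OF h(2)] holomorphic_on_subset[OF k(1)]
               holomorphic_on_subset[OF h(4)]; auto)+
    show "\<not> is_pole f w" if "w \<in> ball z (min r q) - {z}" for w
      using h(4) that
      by (intro not_is_pole_holomorphic[of "ball z r - {z}"]) (auto intro: open_delete)
  qed (use h q k in \<open>auto simp: dist_commute\<close>)
qed

section \<open>The quotient representation and the estimates\<close>

text \<open>
  The denominator is a square root \<open>s\<close> of \<open>-1 / f'\<close>, and the numerator is \<open>f s\<close> with its
  removable singularities filled in: near a pole \<open>f s = s / h\<close>, where both \<open>s\<close> and
  \<open>h\<close> vanish at the pole and the zero of \<open>h\<close> is simple. The Wronskian is computed away from the
  poles and equals 1 at the poles by continuity.
\<close>
theorem locally_univalent_meromorphic_as_quotient: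
  assumes mero: "f nicely_meromorphic_on ball c R"
    and pos: "\<And>z. z \<in> ball c R \<Longrightarrow> spherical_deriv f z > 0"
  obtains w1 w2 where "w1 holomorphic_on ball c R" "w2 holomorphic_on ball c R"
    "\<And>z. z \<in> ball c R \<Longrightarrow> is_pole f z \<longleftrightarrow> w2 z = 0"
    "\<And>z. z \<in> ball c R \<Longrightarrow> f z = w1 z / w2 z"
    "\<And>z. z \<in> ball c R \<Longrightarrow> w1 z * deriv w2 z - w2 z * deriv w1 z = 1"
proof (cases "R > 0")
  case False
  have empty: False if "z \<in> ball c R" for z
    using that False zero_le_dist[of c z] by (simp del: zero_le_dist)
  show ?thesis
    by (rule that[of "\<lambda>_. 0" "\<lambda>_. 0"]) (rule holomorphic_on_const | blast dest: empty)+
next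
  case True
  define D where "D = ball c R"
  have D: "open D" "c \<in> D" using True by (auto simp: D_def)
  have iso: "isolated_singularity_at f z" if "z \<in> D" for z
    using mero that unfolding nicely_meromorphic_on_def D_def
    by (meson meromorphic_on_isolated_singularity meromorphic_on_subset empty_subsetI insert_subset)
  have f_pole: "f z = 0" if "z \<in> D" "is_pole f z" for z
    using mero that not_tendsto_and_filterlim_at_infinity[OF at_neq_bot, of f _ z]
    unfolding nicely_meromorphic_on_def D_def is_pole_def by blast
  have sph_nz: "spherical_deriv f z \<noteq> 0" if "z \<in> D" for z
    using pos[of z] that by (simp add: D_def)
  have deriv_nz: "deriv f z \<noteq> 0" if "z \<in> D" "\<not> is_pole f z" for z
    using pos[of z] that by (auto simp: spherical_deriv_def Let_def D_def)
  define B where "B = {z\<in>D. \<not> is_pole f z}"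
  have nonpole: "\<exists>e>0. ball z e \<subseteq> B \<and> f holomorphic_on ball z e" if "z \<in> B" for z
  proof -
    have "f analytic_on {z}"
      using mero that by (auto simp: B_def D_def intro: nicely_meromorphic_on_imp_analytic_at)
    then obtain e1 where e1: "e1 > 0" "f holomorphic_on ball z e1"
      by (auto simp: analytic_on_def)
    obtain e2 where e2: "e2 > 0" "ball z e2 \<subseteq> D"
      using \<open>z \<in> B\<close> \<open>open D\<close> by (auto simp: B_def elim: openE)
    have "\<not> is_pole f w" if "w \<in> ball z e1" for w
      using e1(2) that by (intro not_is_pole_holomorphic[of "ball z e1"]) auto
    thus ?thesis
      using e1 e2 by (intro exI[of _ "min e1 e2"])
        (auto simp: B_def subset_iff elim: holomorphic_on_subset)
  qed
  have openB: "open B"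
    using nonpole by (auto simp: open_contains_ball)
  have holf: "f holomorphic_on B"
    by (metis analytic_on_def analytic_imp_holomorphic nonpole)
  have evB: "eventually (\<lambda>w. w \<in> B) (at z)" if "z \<in> D" for z
  proof -
    have "eventually (\<lambda>w. \<not> is_pole f w) (at z)"
      using iso[OF that] by (rule eventually_not_pole)
    moreover have "eventually (\<lambda>w. w \<in> D) (at z)"
      using D(1) that by (rule eventually_at_in_open')
    ultimately show ?thesis
      by eventually_elim (auto simp: B_def)
  qed
  have holD: "u holomorphic_on D"
    if "u holomorphic_on B" and *: "\<And>z. z \<in> D - B \<Longrightarrow> \<exists>r>0. u holomorphic_on ball z r" for u
  proof -
    have "u analytic_on {z}" if "z \<in> D" for z
    proof (cases "z \<in> B")
      case True
      thus ?thesis using openB \<open>u holomorphic_on B\<close> by (auto simp: analytic_at)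
    next
      case False
      thus ?thesis using that *[of z] by (auto simp: analytic_on_def)
    qed
    thus ?thesis using analytic_imp_holomorphic analytic_on_analytic_at by blast
  qed
  \<comment> \<open>At a pole, 0 is the limit of \<open>-1 / f' = h\<^sup>2 / h'\<close>.\<close>
  define g where "g = (\<lambda>z. if is_pole f z then 0 else - 1 / deriv f z)"
  have g_pole: "\<exists>r>0. \<exists>v. v holomorphic_on ball z r \<and> v z \<noteq> 0 \<and> (\<forall>w\<in>ball z r. g w = (w - z)\<^sup>2 * v w)"
    if z: "z \<in> D" "is_pole f z" for z
  proof -
    obtain r h k where *: "r > 0" "ball z r \<subseteq> D" "h holomorphic_on ball z r" "k holomorphic_on ball z r"
      "f holomorphic_on ball z r - {z}" "\<And>w. h w = (w - z) * k w"
      "\<And>w. w \<in> ball z r \<Longrightarrow> k w \<noteq> 0" "\<And>w. w \<in> ball z r \<Longrightarrow> deriv h w \<noteq> 0"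
      "\<And>w. w \<in> ball z r - {z} \<Longrightarrow> f w = 1 / h w"
      "\<And>w. w \<in> ball z r - {z} \<Longrightarrow> deriv f w = - deriv h w / (h w)\<^sup>2"
      "\<And>w. w \<in> ball z r - {z} \<Longrightarrow> \<not> is_pole f w"
      using simple_pole_reciprocal[OF D(1) z(1) iso[OF z(1)] z(2) sph_nz[OF z(1)]] by blast
    show ?thesis
    proof (intro exI conjI ballI)
      show "(\<lambda>w. (k w)\<^sup>2 / deriv h w) holomorphic_on ball z r"
        using * by (intro holomorphic_intros) auto
      show "(k z)\<^sup>2 / deriv h z \<noteq> 0" using * by simp
      fix w assume w: "w \<in> ball z r"
      show "g w = (w - z)\<^sup>2 * ((k w)\<^sup>2 / deriv h w)"
      proof (cases "w = z")
        case False
        hence "w \<in> ball z r - {z}" using w by simp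
        thus ?thesis
          using *(10,11) by (simp add: g_def *(6) power_mult_distrib)
      qed (use z in \<open>simp add: g_def\<close>)
    qed fact
  qed
  have "\<exists>s. s holomorphic_on D \<and> (\<forall>z\<in>D. g z = (s z)\<^sup>2)"
  proof -
    have "g holomorphic_on D"
    proof (rule holD)
      have "(\<lambda>z. - 1 / deriv f z) holomorphic_on B"
        using deriv_nz by (intro holomorphic_intros holomorphic_deriv holf openB) (auto simp: B_def)
      thus "g holomorphic_on B"
        by (rule holomorphic_transform) (auto simp: g_def B_def)
      fix z assume "z \<in> D - B"
      then obtain r v where v: "r > 0" "v holomorphic_on ball z r"
          "\<forall>w\<in>ball z r. g w = (w - z)\<^sup>2 * v w"
        using g_pole[of z] by (auto simp: B_def)
      have "(\<lambda>w. (w - z)\<^sup>2 * v w) holomorphic_on ball z r"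
        by (intro holomorphic_intros v)
      hence "g holomorphic_on ball z r"
        by (rule holomorphic_transform) (simp add: v(3))
      thus "\<exists>r>0. g holomorphic_on ball z r"
        using v(1) by blast
    qed
    moreover have g_nz: "g z \<noteq> 0" if "z \<in> B" for z
      using that deriv_nz by (auto simp: g_def B_def)
    moreover obtain p where "p \<in> B"
      using eventually_happens[OF evB[OF D(2)]] by auto
    ultimately show ?thesis
      unfolding D_def using g_pole
      by (intro holomorphic_sqrt_ball_double_zeros[of g c R p]) (auto simp: B_def D_def)
  qed
  then obtain s where s: "s holomorphic_on D" "\<And>z. z \<in> D \<Longrightarrow> g z = (s z)\<^sup>2"
    by blast
  have sB: "(s z)\<^sup>2 = - 1 / deriv f z" "s z \<noteq> 0" if "z \<in> B" for z
    using s(2)[of z] that deriv_nz[of z] by (auto simp: B_def g_def)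
  have s_pole: "s z = 0" if "z \<in> D" "is_pole f z" for z
    using s(2)[of z] that by (simp add: g_def)
  have fsB: "(\<lambda>z. f z * s z) holomorphic_on B"
    by (intro holomorphic_intros holf holomorphic_on_subset[OF s(1)]) (auto simp: B_def)
  define u where "u = remove_sings (\<lambda>z. f z * s z)"
  have uB: "u z = f z * s z" if "z \<in> B" for z
    unfolding u_def using that fsB openB by (intro remove_sings_at_analytic) (auto simp: analytic_at)
  have holu: "u holomorphic_on D"
  proof (rule holD)
    show "u holomorphic_on B"
      using fsB by (rule holomorphic_transform) (simp add: uB)
    fix z assume "z \<in> D - B"
    hence z: "z \<in> D" "is_pole f z" by (auto simp: B_def)
    show "\<exists>r>0. u holomorphic_on ball z r"
    proof -
      obtain r h k where *: "r > 0" "ball z r \<subseteq> D" "h holomorphic_on ball z r" "k holomorphic_on ball z r"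
        "f holomorphic_on ball z r - {z}" "\<And>w. h w = (w - z) * k w"
        "\<And>w. w \<in> ball z r \<Longrightarrow> k w \<noteq> 0" "\<And>w. w \<in> ball z r \<Longrightarrow> deriv h w \<noteq> 0"
        "\<And>w. w \<in> ball z r - {z} \<Longrightarrow> f w = 1 / h w"
        "\<And>w. w \<in> ball z r - {z} \<Longrightarrow> deriv f w = - deriv h w / (h w)\<^sup>2"
        "\<And>w. w \<in> ball z r - {z} \<Longrightarrow> \<not> is_pole f w"
        using simple_pole_reciprocal[OF D(1) z(1) iso[OF z(1)] z(2) sph_nz[OF z(1)]] by blast
      obtain t where t: "t holomorphic_on ball z r" "\<And>w. s w = (w - z) * t w"
        using holomorphic_factor_zero[of s "ball z r" z] s_pole[OF z]
              holomorphic_on_subset[OF s(1) *(2)] by auto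
      have holtk: "(\<lambda>w. t w / k w) holomorphic_on ball z r"
        using * t by (intro holomorphic_intros) auto
      have fs: "f w * s w = t w / k w" if "w \<in> ball z r - {z}" for w
        using that *(6) by (simp add: *(9)[OF that] t(2))
      have "(\<lambda>w. t w / k w) \<midarrow>z\<rightarrow> t z / k z"
        using holomorphic_on_imp_continuous_on[OF holtk] *(1)
        by (simp add: continuous_on_eq_continuous_at isCont_def)
      moreover have "eventually (\<lambda>w. w \<in> ball z r - {z}) (at z)"
        using *(1) by (intro eventually_at_in_open) auto
      hence "eventually (\<lambda>w. t w / k w = f w * s w) (at z)"
        by eventually_elim (simp add: fs)
      ultimately have "(\<lambda>w. f w * s w) \<midarrow>z\<rightarrow> t z / k z"
        by (rule Lim_transform_eventually)
      hence "u z = t z / k z"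
        unfolding u_def by (rule remove_sings_eqI)
      moreover have "u w = t w / k w" if "w \<in> ball z r - {z}" for w
        using *(2,11) that fs[OF that] by (subst uB) (auto simp: B_def)
      ultimately have "u holomorphic_on ball z r"
        by (intro holomorphic_transform[OF holtk]) (metis DiffI singletonD)
      thus ?thesis using *(1) by blast
    qed
  qed
  have WB: "u z * deriv s z - s z * deriv u z = 1" if "z \<in> B" for z
  proof -
    have "z \<in> D" using that by (simp add: B_def)
    have "deriv u z = deriv (\<lambda>z. f z * s z) z"
      using eventually_nhds_in_open[OF openB that] uB
      by (intro deriv_cong_ev refl) (auto elim: eventually_mono)
    also have "\<dots> = f z * deriv s z + deriv f z * s z"
      using holf s(1) that \<open>z \<in> D\<close> openB D(1)
      by (intro deriv_mult) (auto simp: holomorphic_on_imp_differentiable_at)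
    finally have "u z * deriv s z - s z * deriv u z = - deriv f z * (s z)\<^sup>2"
      by (simp add: uB[OF that] algebra_simps power2_eq_square)
    thus ?thesis
      using deriv_nz[of z] that sB(1)[OF that] by (simp add: B_def)
  qed
  have W: "u z * deriv s z - s z * deriv u z = 1" if "z \<in> D" for z
  proof -
    have "(\<lambda>z. u z * deriv s z - s z * deriv u z) holomorphic_on D"
      by (intro holomorphic_intros holomorphic_deriv holu s D)
    hence "(\<lambda>z. u z * deriv s z - s z * deriv u z) \<midarrow>z\<rightarrow> u z * deriv s z - s z * deriv u z"
      using that D(1) holomorphic_on_imp_continuous_on
      by (fastforce simp: continuous_on_eq_continuous_at isCont_def)
    moreover have "(\<lambda>z. u z * deriv s z - s z * deriv u z) \<midarrow>z\<rightarrow> 1"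
      using evB[OF that] WB by (intro tendsto_eventually) (auto elim: eventually_mono)
    ultimately show ?thesis by (rule LIM_unique)
  qed
  show ?thesis
  proof (rule that[of u s])
    show "u holomorphic_on ball c R" "s holomorphic_on ball c R"
      using holu s by (auto simp: D_def)
    fix z assume "z \<in> ball c R"
    hence z: "z \<in> D" by (simp add: D_def)
    show "is_pole f z \<longleftrightarrow> s z = 0"
      using z sB(2)[of z] s_pole[of z] by (auto simp: B_def)
    \<comment> \<open>At a pole both sides are 0: the left by the convention for \<open>f\<close>, the right as a division by 0.\<close>
    show "f z = u z / s z"
    proof (cases "is_pole f z")
      case True
      thus ?thesis using z f_pole s_pole by simp
    next
      case False
      hence "z \<in> B" using z by (simp add: B_def)
      thus ?thesis using sB(2) uB by simp
    qed
    show "u z * deriv s z - s z * deriv u z = 1"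
      by (rule W) fact
  qed
qed

theorem mainTheorem1:
  fixes f :: "complex \<Rightarrow> complex" and \<epsilon> :: real
  assumes "\<epsilon> > 0"
    and "f nicely_meromorphic_on ball 0 1"
    and "\<forall>z\<in>ball 0 1. spherical_deriv f z \<ge> \<epsilon>"
  shows "(\<exists>w1 w2. w1 holomorphic_on ball 0 1 \<and> w2 holomorphic_on ball 0 1 \<and>
            (\<forall>z\<in>ball 0 1.
               (is_pole f z \<longleftrightarrow> w2 z = 0) \<and> f z = w1 z / w2 z \<and>
               (norm (w1 z))\<^sup>2 + (norm (w2 z))\<^sup>2 \<le> 1 / \<epsilon> \<and>
               w1 z * deriv w2 z - w2 z * deriv w1 z = 1 \<and>
               w1 z * deriv (deriv w2) z - w2 z * deriv (deriv w1) z = 0)) \<and>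
         (\<forall>z\<in>ball 0 1.
            spherical_deriv f z \<le> (2 / \<epsilon>) / (1 - norm z)\<^sup>2 \<and>
            norm (schwarzian f z) \<le> (4 / \<epsilon>) / (1 - norm z) ^ 3)"
proof -
  have "spherical_deriv f z > 0" if "z \<in> ball 0 1" for z
    using assms that by fastforce
  from locally_univalent_meromorphic_as_quotient[OF assms(2) this]
  obtain w1 w2 where hol: "w1 holomorphic_on ball 0 1" "w2 holomorphic_on ball 0 1"
    and pole: "\<And>z. z \<in> ball 0 1 \<Longrightarrow> is_pole f z \<longleftrightarrow> w2 z = 0"
    and f: "\<And>z. z \<in> ball 0 1 \<Longrightarrow> f z = w1 z / w2 z"
    and W: "\<And>z. z \<in> ball 0 1 \<Longrightarrow> w1 z * deriv w2 z - w2 z * deriv w1 z = 1"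
    by metis
  note invariants = quotient_unit_wronskian_invariants[OF open_ball hol W pole f]
  \<comment> \<open>\<open>N n z\<close> is the Euclidean norm of the \<open>n\<close>-th derivative of \<open>(w\<^sub>1, w\<^sub>2)\<close>, and \<open>M\<close> bounds \<open>N 0\<close>.\<close>
  define N where "N = (\<lambda>n z. sqrt ((norm ((deriv ^^ n) w1 z))\<^sup>2 + (norm ((deriv ^^ n) w2 z))\<^sup>2))"
  define M where "M = sqrt (1 / \<epsilon>)"
  have M: "M\<^sup>2 = 1 / \<epsilon>" "M \<ge> 0" using \<open>\<epsilon> > 0\<close> by (auto simp: M_def)
  have N_nonneg: "N n z \<ge> 0" for n z by (simp add: N_def)
  have sum_le: "(norm (w1 z))\<^sup>2 + (norm (w2 z))\<^sup>2 \<le> 1 / \<epsilon>" if "z \<in> ball 0 1" for z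
  proof -
    have "\<epsilon> \<le> 1 / ((norm (w1 z))\<^sup>2 + (norm (w2 z))\<^sup>2)"
      using assms(3)[rule_format, OF that] invariants(1)[OF _ _ _ that] by simp
    moreover from this have "(norm (w1 z))\<^sup>2 + (norm (w2 z))\<^sup>2 > 0"
      using \<open>\<epsilon> > 0\<close> by (metis less_le_trans zero_less_divide_1_iff)
    ultimately show ?thesis
      using \<open>\<epsilon> > 0\<close> by (simp add: field_simps)
  qed
  have bounds: "spherical_deriv f z \<le> (2 / \<epsilon>) / (1 - norm z)\<^sup>2 \<and>
                norm (schwarzian f z) \<le> (4 / \<epsilon>) / (1 - norm z) ^ 3" if z: "z \<in> ball 0 1" for z
  proof -
    define R where "R = 1 - norm z"
    have R: "R > 0" using z by (simp add: R_def)
    have sub: "ball z R \<subseteq> ball 0 1"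
      by (simp add: ball_subset_ball_iff R_def)
    have N_le: "N n z \<le> fact n * M / R ^ n" for n
      unfolding N_def
    proof (rule vector_higher_deriv_bound)
      show "sqrt ((norm (w1 w))\<^sup>2 + (norm (w2 w))\<^sup>2) \<le> M" if "w \<in> ball z R" for w
        unfolding M_def using sum_le[of w] sub that by auto
    qed (use hol sub R in \<open>auto elim: holomorphic_on_subset\<close>)
    have "1 = norm (w1 z * deriv w2 z + (- w2 z) * deriv w1 z)"
      using W[OF z] by simp
    also have "\<dots> \<le> N 0 z * N 1 z"
      using norm_vector2_le[of "w1 z" "deriv w2 z" "- w2 z" "deriv w1 z"]
      by (simp add: N_def add.commute)
    finally have N01: "1 \<le> N 0 z * N 1 z" .
    hence "N 0 z \<noteq> 0" by auto
    hence "N 0 z > 0" using N_nonneg[of 0 z] by simp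
    have "spherical_deriv f z = (1 / N 0 z)\<^sup>2"
      using invariants(1)[OF _ _ _ z] by (simp add: N_def power_divide)
    also have "\<dots> \<le> (N 1 z)\<^sup>2"
      using N01 \<open>N 0 z > 0\<close> by (intro power_mono) (auto simp: field_simps)
    also have "\<dots> \<le> (M / R)\<^sup>2"
      using N_le[of 1] N_nonneg by (intro power_mono) auto
    also have "\<dots> = (1 / \<epsilon>) / R\<^sup>2"
      by (simp only: power_divide M)
    also have "\<dots> \<le> (2 / \<epsilon>) / R\<^sup>2"
      using \<open>\<epsilon> > 0\<close> by (intro divide_right_mono) auto
    finally have 1: "spherical_deriv f z \<le> (2 / \<epsilon>) / R\<^sup>2" .
    have "schwarzian f z
        = 2 * (deriv w1 z * deriv (deriv w2) z + (- deriv w2 z) * deriv (deriv w1) z)"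
      using invariants(2)[OF _ _ _ z] by simp
    hence "norm (schwarzian f z)
        = 2 * norm (deriv w1 z * deriv (deriv w2) z + (- deriv w2 z) * deriv (deriv w1) z)"
      by (simp only: norm_mult norm_numeral)
    also have "\<dots> \<le> 2 * (N 1 z * N 2 z)"
      using norm_vector2_le[of "deriv w1 z" "deriv (deriv w2) z" "- deriv w2 z" "deriv (deriv w1) z"]
      by (simp add: N_def add.commute numeral_2_eq_2)
    also have "\<dots> \<le> 2 * ((M / R) * (2 * M / R\<^sup>2))"
      using N_le[of 1] N_le[of 2] N_nonneg M R by (intro mult_left_mono mult_mono) auto
    also have "\<dots> = 4 * M\<^sup>2 / R ^ 3"
      by (simp add: power2_eq_square power3_eq_cube)
    also have "\<dots> = (4 / \<epsilon>) / R ^ 3"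
      by (simp add: M)
    finally have 2: "norm (schwarzian f z) \<le> (4 / \<epsilon>) / R ^ 3" .
    show ?thesis using 1 2 by (simp add: R_def)
  qed
  have W': "w1 z * deriv (deriv w2) z - w2 z * deriv (deriv w1) z = 0" if "z \<in> ball 0 1" for z
    by (rule wronskian_const_imp_deriv2[OF open_ball hol W that])
  show ?thesis
  proof (rule conjI)
    show "\<exists>w1 w2. w1 holomorphic_on ball 0 1 \<and> w2 holomorphic_on ball 0 1 \<and>
            (\<forall>z\<in>ball 0 1.
               (is_pole f z \<longleftrightarrow> w2 z = 0) \<and> f z = w1 z / w2 z \<and>
               (norm (w1 z))\<^sup>2 + (norm (w2 z))\<^sup>2 \<le> 1 / \<epsilon> \<and>
               w1 z * deriv w2 z - w2 z * deriv w1 z = 1 \<and>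
               w1 z * deriv (deriv w2) z - w2 z * deriv (deriv w1) z = 0)"
      by (rule exI[of _ w1], rule exI[of _ w2])
         (intro conjI ballI hol; (rule pole f sum_le W W', assumption))
  qed (intro ballI bounds)
qed

end
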